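(* Let $C_+^{(4)}=\{(x_1,x_2)\in\mathbb{R}^2\colon 0<x_2<x_1\}$. Uniformly in $x=(x_1,x_2)\in C_+^{(4)}$, $y=(y_1,y_2)\in C_+^{(4)}$, and $t>0$, $$ p_t^{\eta_{\mathcal{N}_2},C_+^{(4)}}(x,y)\simeq\frac{x_1y_1}{x_1y_1+t}\cdot\frac{x_2y_2}{x_2y_2+t}\;p_t^{(2)}(x-y). $$
   Context: $p_t^{(2)}(w)=(4\pi t)^{-1}\exp(-\|w\|^2/4t)$, $w\in\mathbb{R}^2$, is the Gauss-Weierstrass kernel. Identify $\mathbb{R}^2\simeq\mathbb{C}$. The dihedral root system $I_2(4)$ is $\{e^{i\pi j/4}\colon j=0,\dots,7\}$, and $W=W(I_2(4))\subset O(2)$ is the group (of order 8) generated by the orthogonal reflections in the lines perpendicular to the vectors of $I_2(4)$; equivalently, $W$ consists of all maps $(x_1,x_2)\mapsto(\varepsilon_1x_1,\varepsilon_2x_2)$ and $(x_1,x_2)\mapsto(\varepsilon_1x_2,\varepsilon_2x_1)$ with $\varepsilon_1,\varepsilon_2\in\{1,-1\}$. The cone $C_+^{(4)}$ is a Weyl chamber for $I_2(4)$. For a homomorphism $\eta\colon W\to\{1,-1\}$, the $\eta$-heat kernel on $C_+^{(4)}$ is given, for $x,y\in C_+^{(4)}$ and $t>0$, by $$p_t^{\eta,C_+^{(4)}}(x,y)=\sum_{g\in W}\eta(g)\,p_t^{(2)}(gx-y).$$ The homomorphism $\eta_{\mathcal{N}_2}$ is the one taking the value $\varepsilon_1\varepsilon_2$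 both on the map $(x_1,x_2)\mapsto(\varepsilon_1x_1,\varepsilon_2x_2)$ and on the map $(x_1,x_2)\mapsto(\varepsilon_1x_2,\varepsilon_2x_1)$; that is, it equals $-1$ on the reflections in the coordinate axes and $1$ on the reflections in the lines $x_2=\pm x_1$. The corresponding kernel is the heat kernel of the Laplacian on $C_+^{(4)}$ with the Dirichlet condition on the boundary half-line $\{(s,0)\colon s\ge0\}$ and the Neumann condition on the boundary half-line $\{(s,s)\colon s>0\}$. $X\simeq Y$ uniformly in the indicated variables means that there is a constant $C>0$, independent of $x,y,t$, with $C^{-1}Y\le X\le CY$. *)

theory Defs
  imports "HOL-Analysis.Analysis" "HOL-Algebra.Bij" "HOL-Algebra.Generated_Groups"
begin

definition gauss_weierstrass2 :: "real \<Rightarrow> real ^ 2 \<Rightarrow> real" where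
  "gauss_weierstrass2 t w = inverse (4 * pi * t) * exp (- ((norm w)\<^sup>2 / (4 * t)))"

text \<open>The vectors \<open>exp (i * pi * j / 4)\<close>, with the complex plane identified with \<open>real ^ 2\<close>.\<close>

definition root_system_I2_4 :: "(real ^ 2) set" where
  "root_system_I2_4 = (\<lambda>j::nat. vector [cos (pi * j / 4), sin (pi * j / 4)]) ` {0..7}"

definition reflection :: "real ^ 2 \<Rightarrow> real ^ 2 \<Rightarrow> real ^ 2" where
  "reflection a x = x - (2 * (x \<bullet> a) / (a \<bullet> a)) *\<^sub>R a"

definition W_I2_4 :: "(real ^ 2 \<Rightarrow> real ^ 2) set" where
  "W_I2_4 = generate (BijGroup UNIV) (reflection ` root_system_I2_4)"

definition C4_plus :: "(real ^ 2) set" where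
  "C4_plus = {x. 0 < x $ 2 \<and> x $ 2 < x $ 1}"

definition eta_heat_kernel ::
  "((real ^ 2 \<Rightarrow> real ^ 2) \<Rightarrow> real) \<Rightarrow> real \<Rightarrow> real ^ 2 \<Rightarrow> real ^ 2 \<Rightarrow> real" where
  "eta_heat_kernel \<eta> t x y = (\<Sum>g\<in>W_I2_4. \<eta> g * gauss_weierstrass2 t (g x - y))"

definition signed_diag :: "real \<Rightarrow> real \<Rightarrow> real ^ 2 \<Rightarrow> real ^ 2" where
  "signed_diag e1 e2 x = vector [e1 * x $ 1, e2 * x $ 2]"

definition signed_swap :: "real \<Rightarrow> real \<Rightarrow> real ^ 2 \<Rightarrow> real ^ 2" where
  "signed_swap e1 e2 x = vector [e1 * x $ 2, e2 * x $ 1]"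

text \<open>
  The value is meaningful only on \<^const>\<open>W_I2_4\<close>; \<open>W_I2_4_eq\<close>, \<open>eta_N2_signed\<close> and
  \<open>eta_N2_hom\<close> below show that there the description is exhaustive, unambiguous and
  multiplicative.
\<close>

definition eta_N2 :: "(real ^ 2 \<Rightarrow> real ^ 2) \<Rightarrow> real" where
  "eta_N2 g = (THE s. \<exists>e1\<in>{1, -1}. \<exists>e2\<in>{1, -1}.
      (g = signed_diag e1 e2 \<or> g = signed_swap e1 e2) \<and> s = e1 * e2)"

lemma signed_nth [simp]:
  "signed_diag e1 e2 x $ 1 = e1 * x $ 1" "signed_diag e1 e2 x $ 2 = e2 * x $ 2"
  "signed_swap e1 e2 x $ 1 = e1 * x $ 2" "signed_swap e1 e2 x $ 2 = e2 * x $ 1"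
  by (simp_all add: signed_diag_def signed_swap_def)

lemma signed_diag_inject: "signed_diag a b = signed_diag c d \<longleftrightarrow> a = c \<and> b = d"
proof
  assume "signed_diag a b = signed_diag c d"
  then have "signed_diag a b (vector [1, 1]) = signed_diag c d (vector [1, 1])" by simp
  then show "a = c \<and> b = d" by (simp add: vec_eq_iff forall_2)
qed simp

lemma signed_swap_inject: "signed_swap a b = signed_swap c d \<longleftrightarrow> a = c \<and> b = d"
proof
  assume "signed_swap a b = signed_swap c d"
  then have "signed_swap a b (vector [1, 1]) = signed_swap c d (vector [1, 1])" by simp
  then show "a = c \<and> b = d" by (simp add: vec_eq_iff forall_2)
qed simp

lemma signed_diag_neq_swap: "a \<noteq> 0 \<Longrightarrow> signed_diag a b \<noteq> signed_swap c d"
proof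
  assume "a \<noteq> 0" "signed_diag a b = signed_swap c d"
  then have "signed_diag a b (vector [1, 0]) = signed_swap c d (vector [1, 0])" by simp
  with \<open>a \<noteq> 0\<close> show False by (simp add: vec_eq_iff forall_2)
qed

lemma eta_N2_signed:
  assumes "e1 \<in> {1, -1}" "e2 \<in> {1, -1}"
  shows "eta_N2 (signed_diag e1 e2) = e1 * e2" "eta_N2 (signed_swap e1 e2) = e1 * e2"
proof -
  have e1: "e1 \<noteq> 0" using assms(1) by auto
  show "eta_N2 (signed_diag e1 e2) = e1 * e2"
    unfolding eta_N2_def
  proof (rule the_equality)
    fix s assume "\<exists>a\<in>{1, -1}. \<exists>b\<in>{1, -1}.
      (signed_diag e1 e2 = signed_diag a b \<or> signed_diag e1 e2 = signed_swap a b) \<and> s = a * b"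
    then obtain a b where "signed_diag e1 e2 = signed_diag a b" "s = a * b"
      using signed_diag_neq_swap[OF e1] by blast
    then show "s = e1 * e2" by (simp add: signed_diag_inject)
  qed (intro bexI[of _ e1] bexI[of _ e2] conjI disjI1 refl assms)
  show "eta_N2 (signed_swap e1 e2) = e1 * e2"
    unfolding eta_N2_def
  proof (rule the_equality)
    fix s assume "\<exists>a\<in>{1, -1}. \<exists>b\<in>{1, -1}.
      (signed_swap e1 e2 = signed_diag a b \<or> signed_swap e1 e2 = signed_swap a b) \<and> s = a * b"
    then obtain a b where *: "a \<in> {1, -1}" "s = a * b"
      "signed_swap e1 e2 = signed_diag a b \<or> signed_swap e1 e2 = signed_swap a b" by blast
    have "a \<noteq> 0" using *(1) by auto
    then have "signed_swap e1 e2 = signed_swap a b"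
      using *(3) signed_diag_neq_swap[of a b e1 e2] by simp
    then show "s = e1 * e2" using *(2) by (simp add: signed_swap_inject)
  qed (intro bexI[of _ e1] bexI[of _ e2] conjI disjI2 refl assms)
qed

lemma signed_comp:
  "signed_diag a b \<circ> signed_diag c d = signed_diag (a * c) (b * d)"
  "signed_diag a b \<circ> signed_swap c d = signed_swap (a * c) (b * d)"
  "signed_swap a b \<circ> signed_diag c d = signed_swap (a * d) (b * c)"
  "signed_swap a b \<circ> signed_swap c d = signed_diag (a * d) (b * c)"
  by (auto simp: fun_eq_iff vec_eq_iff forall_2)

lemma signed_diag_one: "signed_diag 1 1 = id"
  by (auto simp: fun_eq_iff vec_eq_iff forall_2)

lemma cos_135: "cos (pi * 3 / 4) = - sqrt 2 / 2"
  using cos_pi_minus[of "pi / 4"] by (simp add: cos_45 field_simps)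

lemma sin_135: "sin (pi * 3 / 4) = sqrt 2 / 2"
  using sin_pi_minus[of "pi / 4"] by (simp add: sin_45 field_simps)

lemma reflection_uminus: "reflection (- a) = reflection a"
  by (auto simp: reflection_def fun_eq_iff)

lemma reflections_I2_4:
  "reflection ` root_system_I2_4 =
    {signed_diag (-1) 1, signed_swap (-1) (-1), signed_diag 1 (-1), signed_swap 1 1}"
proof -
  define v :: "nat \<Rightarrow> real ^ 2"
    where "v = (\<lambda>j. vector [cos (pi * real j / 4), sin (pi * real j / 4)])"
  have r0: "reflection (v 0) = signed_diag (-1) 1"
    by (auto simp: reflection_def v_def fun_eq_iff vec_eq_iff forall_2 inner_vec_def sum_2)
  have r1: "reflection (v 1) = signed_swap (-1) (-1)"
    by (auto simp: reflection_def v_def fun_eq_iff vec_eq_iff forall_2 inner_vec_def sum_2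
        cos_45 sin_45 field_simps)
  have r2: "reflection (v 2) = signed_diag 1 (-1)"
    by (auto simp: reflection_def v_def fun_eq_iff vec_eq_iff forall_2 inner_vec_def sum_2)
  have r3: "reflection (v 3) = signed_swap 1 1"
    by (auto simp: reflection_def v_def fun_eq_iff vec_eq_iff forall_2 inner_vec_def sum_2
        cos_135 sin_135 field_simps)
  have "v (j + 4) = - v j" for j
  proof -
    have "pi * real (j + 4) / 4 = pi * real j / 4 + pi" by (simp add: field_simps)
    then have "cos (pi * real (j + 4) / 4) = - cos (pi * real j / 4)"
      "sin (pi * real (j + 4) / 4) = - sin (pi * real j / 4)"
      by (simp_all only: cos_periodic_pi sin_periodic_pi)
    then show ?thesis by (simp only: v_def vec_eq_iff forall_2 vector_2 vector_uminus_component)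
  qed
  then have *: "reflection (v (j + 4)) = reflection (v j)" for j
    by (simp add: reflection_uminus)
  have "{0..7::nat} = {0, 1, 2, 3, 0 + 4, 1 + 4, 2 + 4, 3 + 4}" by auto
  then have "reflection ` root_system_I2_4 =
      (\<lambda>j. reflection (v j)) ` {0, 1, 2, 3, 0 + 4, 1 + 4, 2 + 4, 3 + 4}"
    unfolding root_system_I2_4_def v_def by (simp add: image_image)
  also have "\<dots> = {reflection (v 0), reflection (v 1), reflection (v 2), reflection (v 3)}"
    unfolding image_insert image_empty * by blast
  finally show ?thesis by (simp only: r0 r1 r2 r3)
qed

lemma W_I2_4_eq:
  "W_I2_4 = (\<Union>e1\<in>{1, -1}. \<Union>e2\<in>{1, -1}. {signed_diag e1 e2, signed_swap e1 e2})"
proof -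
  let ?G = "BijGroup (UNIV :: (real ^ 2) set)" and ?R = "reflection ` root_system_I2_4"
  interpret group ?G by (rule group_BijGroup)
  define S where "S = (\<Union>e1\<in>{1, -1}. \<Union>e2\<in>{1, -1}. {signed_diag e1 e2, signed_swap e1 e2})"
  have S_iff: "g \<in> S \<longleftrightarrow> (\<exists>e1\<in>{1, -1}. \<exists>e2\<in>{1, -1}. g = signed_diag e1 e2 \<or> g = signed_swap e1 e2)" for g
    unfolding S_def by blast
  have S_I: "signed_diag a b \<in> S" "signed_swap a b \<in> S" if "a \<in> {1, -1}" "b \<in> {1, -1}" for a b
    unfolding S_def using that by blast+
  have S_cases: P if "g \<in> S"
    "\<And>a b. a \<in> {1, -1} \<Longrightarrow> b \<in> {1, -1} \<Longrightarrow> g = signed_diag a b \<Longrightarrow> P"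
    "\<And>a b. a \<in> {1, -1} \<Longrightarrow> b \<in> {1, -1} \<Longrightarrow> g = signed_swap a b \<Longrightarrow> P" for P g
    using that(1) unfolding S_iff using that(2,3) by blast
  have sq: "a * (b * (a * b)) = 1" "a * a = 1" if "a \<in> {1, -1}" "b \<in> {1, -1}" for a b :: real
    using that by auto
  have sgn: "a * b \<in> {1, -1}" if "a \<in> {1, -1}" "b \<in> {1, -1}" for a b :: real
    using that by auto
  have order4: "g \<circ> (g \<circ> (g \<circ> g)) = id" if "g \<in> S" for g
    using that
  proof (rule S_cases)
    fix a b :: real
    assume ab: "a \<in> {1, -1}" "b \<in> {1, -1}"
    show "g \<circ> (g \<circ> (g \<circ> g)) = id" if "g = signed_diag a b"
      using sq[OF ab] sq[OF ab(2) ab(1)] by (simp add: that signed_comp signed_diag_one)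
    show "g \<circ> (g \<circ> (g \<circ> g)) = id" if "g = signed_swap a b"
      using sq[OF ab] sq[OF ab(2) ab(1)] by (simp add: that signed_comp signed_diag_one)
  qed
  have comp_S: "f \<circ> g \<in> S" if "f \<in> S" "g \<in> S" for f g
    using that(1)
  proof (rule S_cases)
    fix a b assume f: "a \<in> {1, -1}" "b \<in> {1, -1}" "f = signed_diag a b"
    from that(2) show ?thesis
      by (rule S_cases) (simp_all only: f(3) signed_comp S_I sgn f(1,2))
  next
    fix a b assume f: "a \<in> {1, -1}" "b \<in> {1, -1}" "f = signed_swap a b"
    from that(2) show ?thesis
      by (rule S_cases) (simp_all only: f(3) signed_comp S_I sgn f(1,2))
  qed
  have carr: "g \<in> carrier ?G" if "g \<in> S" for g
  proof -
    have "g \<circ> (g \<circ> g \<circ> g) = id" "(g \<circ> g \<circ> g) \<circ> g = id"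
      using order4[OF that] by (simp_all only: comp_assoc)
    then have "bij g" using o_bij by blast
    then show ?thesis by (simp add: BijGroup_def Bij_def)
  qed
  have mult: "f \<otimes>\<^bsub>?G\<^esub> g = f \<circ> g" if "f \<in> S" "g \<in> S" for f g
    using carr[OF that(1)] carr[OF that(2)] by (simp add: BijGroup_def compose_def fun_eq_iff)
  have one: "\<one>\<^bsub>?G\<^esub> = id"
    by (simp add: BijGroup_def fun_eq_iff)
  have id_S: "id \<in> S" using S_I(1)[of 1 1] by (simp add: signed_diag_one)
  have RS: "g \<in> S" and RR: "inv\<^bsub>?G\<^esub> g = g" if "g \<in> ?R" for g
  proof -
    have *: "g \<in> {signed_diag (-1) 1, signed_swap (-1) (-1), signed_diag 1 (-1), signed_swap 1 1}"
      using that unfolding reflections_I2_4 .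
    then show g: "g \<in> S"
      by (elim insertE emptyE) (simp_all only: S_I insert_iff simp_thms)
    have "g \<circ> g = id"
      using * by (elim insertE emptyE) (simp_all add: signed_comp signed_diag_one)
    then show "inv\<^bsub>?G\<^esub> g = g"
      by (intro inv_equality carr g) (simp only: mult g one)
  qed
  have "W_I2_4 = S"
  proof
    show "W_I2_4 \<subseteq> S"
    proof
      fix g assume "g \<in> W_I2_4"
      then show "g \<in> S" unfolding W_I2_4_def
      proof (induction rule: generate.induct)
        case one
        show ?case using id_S by (simp only: \<open>\<one>\<^bsub>?G\<^esub> = id\<close>)
      next
        case (incl h)
        then show ?case by (rule RS)
      next
        case (inv h)
        then show ?case using RS RR by simp
      next
        case (eng f g)
        then show ?case by (simp only: mult comp_S)
      qed
    qed
    have W: "f \<circ> g \<in> W_I2_4" if "f \<in> W_I2_4" "g \<in> W_I2_4" "f \<in> S" "g \<in> S" for f g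
      using generate.eng[of f ?G ?R g] that(1,2) mult[OF that(3,4)] unfolding W_I2_4_def by simp
    have R: "g \<in> W_I2_4" if "g \<in> ?R" for g
      unfolding W_I2_4_def using that by (rule generate.incl)
    have r: "signed_diag (-1) 1 \<in> W_I2_4" "signed_swap (-1) (-1) \<in> W_I2_4"
        "signed_diag 1 (-1) \<in> W_I2_4" "signed_swap 1 1 \<in> W_I2_4"
      by (rule R, simp add: reflections_I2_4)+
    have s: "signed_diag 1 1 \<in> W_I2_4" "signed_diag (-1) (-1) \<in> W_I2_4"
        "signed_swap 1 (-1) \<in> W_I2_4" "signed_swap (-1) 1 \<in> W_I2_4"
      using W[OF r(1) r(1)] W[OF r(1) r(3)] W[OF r(3) r(4)] W[OF r(1) r(4)]
      by (simp_all add: signed_comp S_I)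
    show "S \<subseteq> W_I2_4"
    proof
      fix g assume "g \<in> S"
      then show "g \<in> W_I2_4"
        by (rule S_cases) (elim insertE emptyE; simp only: r s)+
    qed
  qed
  then show ?thesis unfolding S_def .
qed

lemma eta_N2_hom:
  assumes "f \<in> W_I2_4" "g \<in> W_I2_4"
  shows "eta_N2 (f \<circ> g) = eta_N2 f * eta_N2 g"
proof -
  obtain a b where f: "a \<in> {1, -1}" "b \<in> {1, -1}" "f = signed_diag a b \<or> f = signed_swap a b"
    using assms(1) unfolding W_I2_4_eq by blast
  obtain c d where g: "c \<in> {1, -1}" "d \<in> {1, -1}" "g = signed_diag c d \<or> g = signed_swap c d"
    using assms(2) unfolding W_I2_4_eq by blast
  have "a * c \<in> {1, -1}" "a * d \<in> {1, -1}" "b * c \<in> {1, -1}" "b * d \<in> {1, -1}"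
    using f(1,2) g(1,2) by auto
  note sgn = eta_N2_signed[OF this(1) this(4)] eta_N2_signed[OF this(2) this(3)]
  from f(3) g(3) show ?thesis
    by (elim disjE)
       (simp_all only: signed_comp sgn eta_N2_signed[OF f(1,2)] eta_N2_signed[OF g(1,2)] ac_simps)
qed

end

theory Submission
  imports Defs
begin

text \<open>
  Put \<open>A = x\<^sub>1y\<^sub>1/t\<close>, \<open>B = x\<^sub>2y\<^sub>2/t\<close> and, for the swapped pairing, \<open>C = x\<^sub>2y\<^sub>1/t\<close>,
  \<open>D = x\<^sub>1y\<^sub>2/t\<close>. Since each \<open>g \<in> W\<close> is an isometry, the heat kernel at \<open>g x - y\<close> differs from the
  one at \<open>x - y\<close> only by the factor \<open>exp ((\<langle>g x, y\<rangle> - \<langle>x, y\<rangle>) / (2 t))\<close>, and the alternating signs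
  make the sum over each of the two cosets of the sign changes factorize over the coordinates:
  the \<open>\<eta>\<close>-kernel divided by the free kernel is
  \<open>(1 - exp (- A)) (1 - exp (- B)) + exp (- \<delta> / 2) (1 - exp (- C)) (1 - exp (- D))\<close>
  with \<open>\<delta> = A + B - C - D\<close>
  (lemma \<open>eta_heat_kernel_N2_factor\<close>). As \<open>1 - exp (- s)\<close> is comparable with \<open>s / (s + 1)\<close>, the first
  summand is comparable with the claimed factor, which gives the lower bound because the second
  summand is nonnegative.

  For the upper bound the second summand has to be absorbed into the first. The products agree,
  \<open>A B = C D\<close>, and \<open>\<delta> = (x\<^sub>1 - x\<^sub>2) (y\<^sub>1 - y\<^sub>2) / t \<ge> 0\<close> in the chamber. Hence replacing
  \<open>(1 + C) (1 + D)\<close> by \<open>(1 + A) (1 + B)\<close> in the denominator costs at most a factor \<open>1 + \<delta>\<close>, and this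
  is paid for by the exponential \<open>exp (- \<delta> / 2)\<close> (lemma \<open>swapped_term_absorbed\<close>).
\<close>

section \<open>Elementary estimates\<close>

lemma one_minus_exp_ge:
  fixes s :: real
  assumes "s \<ge> 0"
  shows "s / (s + 1) \<le> 1 - exp (- s)"
proof -
  have "exp (- s) \<le> inverse (s + 1)"
    using exp_ge_add_one_self[of s] assms by (simp add: exp_minus add.commute le_imp_inverse_le)
  also have "\<dots> = 1 - s / (s + 1)"
    using assms by (simp add: field_simps)
  finally show ?thesis by simp
qed

lemma one_minus_exp_le:
  fixes s :: real
  assumes "s \<ge> 0"
  shows "1 - exp (- s) \<le> 2 * (s / (s + 1))"
proof -
  have "1 - exp (- s) \<le> min 1 s"
    using exp_ge_add_one_self[of "- s"] by simp
  also have "\<dots> \<le> 2 * (s / (s + 1))"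
  proof (cases "s \<le> 1")
    case True
    then have "s * s \<le> s"
      using assms by (simp add: mult_left_le)
    then show ?thesis using True assms by (simp add: field_simps)
  qed (simp add: field_simps)
  finally show ?thesis .
qed

text \<open>
  With equal products \<open>P = A B = C D\<close>, the ratio of the denominators is
  \<open>(1 + A + B + P) / (1 + C + D + P) \<le> 1 + \<delta>\<close> with \<open>\<delta> = A + B - C - D\<close>, and \<open>1 + \<delta> \<le> 2 exp (\<delta> / 2)\<close>.
\<close>

lemma swapped_term_absorbed:
  fixes A B C D :: real
  assumes pos: "A \<ge> 0" "B \<ge> 0" "C \<ge> 0" "D \<ge> 0"
    and prod: "C * D = A * B" and sum: "C + D \<le> A + B"
  shows "exp (- (A + B - C - D) / 2) * (C / (C + 1) * (D / (D + 1)))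
    \<le> 2 * (A / (A + 1) * (B / (B + 1)))"
proof -
  define d where "d = A + B - C - D"
  have d: "d \<ge> 0" using sum by (simp add: d_def)
  have exponent: "- (A + B - C - D) / 2 = - (d / 2)"
    by (simp add: d_def field_simps)
  have den: "(A + 1) * (B + 1) > 0" "(C + 1) * (D + 1) > 0"
    using pos by simp_all
  have CD: "(C + 1) * (D + 1) \<ge> 1"
    using mult_nonneg_nonneg[OF pos(3,4)] pos by (simp add: algebra_simps)
  have "(A + 1) * (B + 1) = (C + 1) * (D + 1) + d"
    using prod by (simp add: d_def algebra_simps)
  also have "\<dots> \<le> (1 + d) * ((C + 1) * (D + 1))"
    using mult_left_mono[OF CD d] by (simp only: distrib_right mult_1)
  also have "\<dots> \<le> 2 * exp (d / 2) * ((C + 1) * (D + 1))"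
  proof (rule mult_right_mono)
    show "1 + d \<le> 2 * exp (d / 2)"
      using exp_ge_add_one_self[of "d / 2"] by linarith
  qed (use den in simp)
  finally have "exp (- (d / 2)) * ((A + 1) * (B + 1))
      \<le> exp (- (d / 2)) * (2 * exp (d / 2) * ((C + 1) * (D + 1)))"
    by (intro mult_left_mono) simp_all
  also have "\<dots> = 2 * ((C + 1) * (D + 1))"
    by (simp add: exp_minus)
  finally have "exp (- (d / 2)) / ((C + 1) * (D + 1)) \<le> 2 / ((A + 1) * (B + 1))"
    using den by (simp only: divide_le_eq le_divide_eq if_True times_divide_eq_left)
  then have "A * B * (exp (- (d / 2)) / ((C + 1) * (D + 1))) \<le> A * B * (2 / ((A + 1) * (B + 1)))"
    using pos by (intro mult_left_mono) simp_all
  moreover have "exp (- (A + B - C - D) / 2) * (C / (C + 1) * (D / (D + 1)))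
      = A * B * (exp (- (d / 2)) / ((C + 1) * (D + 1)))"
    unfolding exponent using prod by simp
  moreover have "2 * (A / (A + 1) * (B / (B + 1))) = A * B * (2 / ((A + 1) * (B + 1)))"
    by simp
  ultimately show ?thesis by (simp only:)
qed

section \<open>The kernel as a multiple of the free heat kernel\<close>

lemma sum_W_I2_4:
  fixes f :: "(real ^ 2 \<Rightarrow> real ^ 2) \<Rightarrow> real"
  shows "(\<Sum>g\<in>W_I2_4. f g)
    = (\<Sum>e1\<in>{1, -1}. \<Sum>e2\<in>{1, -1}. f (signed_diag e1 e2) + f (signed_swap e1 e2))"
proof -
  have W: "W_I2_4 = {signed_diag 1 1, signed_diag 1 (-1), signed_diag (-1) 1, signed_diag (-1) (-1),
      signed_swap 1 1, signed_swap 1 (-1), signed_swap (-1) 1, signed_swap (-1) (-1)}"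
    unfolding W_I2_4_eq by auto
  show ?thesis
    unfolding W
    by (simp add: signed_diag_inject signed_swap_inject signed_diag_neq_swap)
qed

lemma gauss_weierstrass2_isometry:
  assumes "t > 0" and "norm u = norm x"
  shows "gauss_weierstrass2 t (u - y)
    = gauss_weierstrass2 t (x - y) * exp ((u \<bullet> y / t - x \<bullet> y / t) / 2)"
proof -
  have n: "(norm (v - y))\<^sup>2 = (norm v)\<^sup>2 + (norm y)\<^sup>2 - 2 * (v \<bullet> y)" for v
    by (simp add: power2_norm_eq_inner inner_diff_left inner_diff_right inner_commute)
  have "- ((norm (u - y))\<^sup>2 / (4 * t))
      = - ((norm (x - y))\<^sup>2 / (4 * t)) + (u \<bullet> y / t - x \<bullet> y / t) / 2"
    unfolding n assms(2) using assms(1) by (simp add: field_simps)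
  then show ?thesis
    by (simp only: gauss_weierstrass2_def exp_add mult.assoc)
qed

lemma norm_signed:
  assumes "e1 \<in> {1, -1}" "e2 \<in> {1, -1}"
  shows "norm (signed_diag e1 e2 x) = norm x" "norm (signed_swap e1 e2 x) = norm x"
  using assms by (auto simp: norm_eq inner_vec_def sum_2)

text \<open>
  The alternating sum over independent signs of both coordinates is a product of one alternating
  sum per coordinate.
\<close>

lemma alternating_exp_sum:
  fixes a b c :: real
  shows "(\<Sum>e1\<in>{1, -1}. \<Sum>e2\<in>{1, -1}. e1 * e2 * exp ((e1 * a + e2 * b - c) / 2))
    = exp (- (c - a - b) / 2) * ((1 - exp (- a)) * (1 - exp (- b)))"
proof -
  have split: "exp ((e1 * a + e2 * b - c) / 2)
      = exp (- (c - a - b) / 2) * (exp ((e1 - 1) * a / 2) * exp ((e2 - 1) * b / 2))" for e1 e2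
    by (simp add: exp_add [symmetric] field_simps)
  have signs: "(\<Sum>e\<in>{1, -1}. h e) = h 1 + h (-1)" for h :: "real \<Rightarrow> real"
    by simp
  show ?thesis
    unfolding signs split by (simp add: algebra_simps)
qed

lemma eta_heat_kernel_N2_factor:
  fixes x y :: "real ^ 2" and t :: real
  assumes "t > 0"
  defines "A \<equiv> x $ 1 * y $ 1 / t" and "B \<equiv> x $ 2 * y $ 2 / t"
    and "C \<equiv> x $ 2 * y $ 1 / t" and "D \<equiv> x $ 1 * y $ 2 / t"
  shows "eta_heat_kernel eta_N2 t x y = gauss_weierstrass2 t (x - y) *
    ((1 - exp (- A)) * (1 - exp (- B))
      + exp (- (A + B - C - D) / 2) * ((1 - exp (- C)) * (1 - exp (- D))))"
proof -
  let ?p = "gauss_weierstrass2 t (x - y)"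
  have xy: "x \<bullet> y / t = A + B"
    by (simp add: A_def B_def inner_vec_def sum_2 add_divide_distrib)
  have diag: "signed_diag e1 e2 x \<bullet> y / t = e1 * A + e2 * B" for e1 e2
    by (simp add: A_def B_def inner_vec_def sum_2 add_divide_distrib mult.assoc)
  have swap: "signed_swap e1 e2 x \<bullet> y / t = e1 * C + e2 * D" for e1 e2
    by (simp add: C_def D_def inner_vec_def sum_2 add_divide_distrib mult.assoc)
  have "eta_heat_kernel eta_N2 t x y = (\<Sum>e1\<in>{1, -1}. \<Sum>e2\<in>{1, -1}.
      ?p * (e1 * e2 * exp ((e1 * A + e2 * B - (A + B)) / 2))
      + ?p * (e1 * e2 * exp ((e1 * C + e2 * D - (A + B)) / 2)))"
    unfolding eta_heat_kernel_def sum_W_I2_4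
  proof (intro sum.cong refl)
    fix e1 e2 :: real
    assume e: "e1 \<in> {1, -1}" "e2 \<in> {1, -1}"
    show "eta_N2 (signed_diag e1 e2) * gauss_weierstrass2 t (signed_diag e1 e2 x - y)
        + eta_N2 (signed_swap e1 e2) * gauss_weierstrass2 t (signed_swap e1 e2 x - y)
      = ?p * (e1 * e2 * exp ((e1 * A + e2 * B - (A + B)) / 2))
        + ?p * (e1 * e2 * exp ((e1 * C + e2 * D - (A + B)) / 2))"
      unfolding eta_N2_signed[OF e] gauss_weierstrass2_isometry[OF assms(1) norm_signed(1)[OF e]]
        gauss_weierstrass2_isometry[OF assms(1) norm_signed(2)[OF e]] diag swap xy
      by (simp only: mult_ac)
  qed
  also have "\<dots> =
      ?p * (\<Sum>e1\<in>{1, -1}. \<Sum>e2\<in>{1, -1}. e1 * e2 * exp ((e1 * A + e2 * B - (A + B)) / 2))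
      + ?p * (\<Sum>e1\<in>{1, -1}. \<Sum>e2\<in>{1, -1}. e1 * e2 * exp ((e1 * C + e2 * D - (A + B)) / 2))"
    by (simp only: sum.distrib sum_distrib_left)
  also have "\<dots> = ?p * (exp (- (A + B - A - B) / 2) * ((1 - exp (- A)) * (1 - exp (- B))))
      + ?p * (exp (- (A + B - C - D) / 2) * ((1 - exp (- C)) * (1 - exp (- D))))"
    by (simp only: alternating_exp_sum)
  also have "\<dots> = ?p * ((1 - exp (- A)) * (1 - exp (- B))
      + exp (- (A + B - C - D) / 2) * ((1 - exp (- C)) * (1 - exp (- D))))"
    by (simp add: distrib_left)
  finally show ?thesis .
qed

section \<open>The two-sided estimate\<close>

theorem proposition4p1:
  shows "\<exists>C::real. C > 0 \<and>
    (\<forall>x\<in>C4_plus. \<forall>y\<in>C4_plus. \<forall>t::real. t > 0 \<longrightarrow>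
      (let Y = (x $ 1 * y $ 1) / (x $ 1 * y $ 1 + t) * ((x $ 2 * y $ 2) / (x $ 2 * y $ 2 + t))
               * gauss_weierstrass2 t (x - y)
       in inverse C * Y \<le> eta_heat_kernel eta_N2 t x y \<and>
          eta_heat_kernel eta_N2 t x y \<le> C * Y))"
  \<comment> \<open>Each \<open>1 - exp (- s) \<le> 2 s / (s + 1)\<close> contributes a factor 2, hence 4 from the first summand; the
      second one contributes 4 times the 2 from absorbing it.\<close>
proof (intro exI[of _ "12 :: real"] conjI ballI allI impI)
  fix x y :: "real ^ 2" and t :: real
  assume x: "x \<in> C4_plus" and y: "y \<in> C4_plus" and t: "t > 0"
  define A B C D where "A = x $ 1 * y $ 1 / t" and "B = x $ 2 * y $ 2 / t"
    and "C = x $ 2 * y $ 1 / t" and "D = x $ 1 * y $ 2 / t"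
  note ABCD = A_def B_def C_def D_def
  define p where "p = gauss_weierstrass2 t (x - y)"
  define Q where "Q = A / (A + 1) * (B / (B + 1))"
  define R where "R = exp (- (A + B - C - D) / 2) * ((1 - exp (- C)) * (1 - exp (- D)))"
  have coord: "0 < x $ 2" "x $ 2 < x $ 1" "0 < y $ 2" "y $ 2 < y $ 1"
    using x y by (simp_all add: C4_plus_def)
  then have nonneg: "A \<ge> 0" "B \<ge> 0" "C \<ge> 0" "D \<ge> 0"
    using t by (simp_all add: ABCD)
  have prod: "C * D = A * B"
    by (simp add: ABCD)
  have "A + B - (C + D) = (x $ 1 - x $ 2) * (y $ 1 - y $ 2) / t"
    using t by (simp add: ABCD field_simps)
  also have "\<dots> \<ge> 0"
    using coord t by simp
  finally have sum: "C + D \<le> A + B" by simp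
  have p: "p \<ge> 0"
    using t by (simp add: p_def gauss_weierstrass2_def)
  have kernel: "eta_heat_kernel eta_N2 t x y = p * ((1 - exp (- A)) * (1 - exp (- B)) + R)"
    unfolding eta_heat_kernel_N2_factor[OF t] p_def R_def ABCD ..
  have quot: "a / (a + t) = a / t / (a / t + 1)" for a
    using t by (simp add: field_simps)
  have Y: "(x $ 1 * y $ 1) / (x $ 1 * y $ 1 + t) * ((x $ 2 * y $ 2) / (x $ 2 * y $ 2 + t))
      * gauss_weierstrass2 t (x - y) = p * Q"
    unfolding Q_def p_def ABCD quot[of "x $ 1 * y $ 1"] quot[of "x $ 2 * y $ 2"]
    by (simp only: mult.commute)
  have Q: "Q \<ge> 0"
    using nonneg by (simp add: Q_def)
  have R: "R \<ge> 0"
    using nonneg by (simp add: R_def)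
  have lower: "Q \<le> (1 - exp (- A)) * (1 - exp (- B))"
    unfolding Q_def using nonneg by (intro mult_mono one_minus_exp_ge) simp_all
  have "(1 - exp (- A)) * (1 - exp (- B)) \<le> (2 * (A / (A + 1))) * (2 * (B / (B + 1)))"
    using nonneg by (intro mult_mono one_minus_exp_le) simp_all
  then have upper: "(1 - exp (- A)) * (1 - exp (- B)) \<le> 4 * Q"
    by (simp add: Q_def)
  have "(1 - exp (- C)) * (1 - exp (- D)) \<le> (2 * (C / (C + 1))) * (2 * (D / (D + 1)))"
    using nonneg by (intro mult_mono one_minus_exp_le) simp_all
  then have "R \<le> exp (- (A + B - C - D) / 2) * ((2 * (C / (C + 1))) * (2 * (D / (D + 1))))"
    unfolding R_def by (intro mult_left_mono) simp_all
  also have "\<dots> = 4 * (exp (- (A + B - C - D) / 2) * (C / (C + 1) * (D / (D + 1))))"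
    by simp
  also have "\<dots> \<le> 4 * (2 * Q)"
    unfolding Q_def by (intro mult_left_mono swapped_term_absorbed nonneg prod sum) simp
  finally have absorbed: "R \<le> 8 * Q" by simp
  have "inverse 12 * (p * Q) \<le> p * Q"
    using p Q by simp
  also have "\<dots> \<le> eta_heat_kernel eta_N2 t x y"
    unfolding kernel using lower R p by (intro mult_left_mono) simp_all
  finally have "inverse 12 * (p * Q) \<le> eta_heat_kernel eta_N2 t x y" .
  moreover have "eta_heat_kernel eta_N2 t x y \<le> p * (12 * Q)"
    unfolding kernel using upper absorbed p by (intro mult_left_mono) simp_all
  then have "eta_heat_kernel eta_N2 t x y \<le> 12 * (p * Q)"
    by simp
  ultimately show "let Y = (x $ 1 * y $ 1) / (x $ 1 * y $ 1 + t)
          * ((x $ 2 * y $ 2) / (x $ 2 * y $ 2 + t)) * gauss_weierstrass2 t (x - y)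
       in inverse 12 * Y \<le> eta_heat_kernel eta_N2 t x y \<and>
          eta_heat_kernel eta_N2 t x y \<le> 12 * Y"
    unfolding Let_def Y by simp
qed simp

end
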